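(* Let $K$ be a field of characteristic zero and let $L_n$ be the free metabelian Leibniz algebra over $K$ on $x_1,\ldots,x_n$. Let $\mathrm{Inn}(L_n^{S_n})$ be the group of inner automorphisms $\psi_u$, $u\in L_n'$, of $L_n$ preserving symmetric polynomials, i.e. such that $\psi_u(v)\in L_n^{S_n}$ for every $v\in L_n^{S_n}$. Then $$\mathrm{Inn}(L_n^{S_n})=\{\psi_{u_1+u_2}\mid u_1\in \mathrm{Ann}(L_n),\ u_2\in (L_n')^{S_n}\}.$$
   Context: A Leibniz algebra over $K$ is a $K$-vector space with a bilinear bracket $[\cdot,\cdot]$ satisfying $[[x,y],z]=[[x,z],y]+[x,[y,z]]$ for all $x,y,z$. $L_n$ is the free algebra with free generators $X_n=\{x_1,\ldots,x_n\}$ in the variety of Leibniz algebras over $K$ satisfying the metabelian identity $[[x,y],[z,t]]=0$. $L_n'=[L_n,L_n]$ is its commutator ideal. $\mathrm{Ann}(L_n)$ is the (two-sided) ideal of $L_n$ generated by all elements $[x,x]$, $x\in L_n$. The symmetric group $S_n$ acts on $L_n$ by algebra automorphisms with $\sigma x_i=x_{\sigma(i)}$; $L_n^{S_n}$ is the subalgebra of elements fixed by all $\sigma\in S_n$ (the symmetric polynomials), and $(L_n')^{S_n}=L_n'\cap L_n^{S_n}$. For $u\in L_n'$, $\mathrm{ad}\,u:L_n\to L_n$ is $\mathrm{ad}\,u(v)=[v,u]$; it satisfies $(\mathrm{ad}\,u)^2=0$, and $\psi_u=\exp(\mathrm{ad}\,u)=1+\mathrm{ad}\,u$, i.e. $\psi_u(v)=v+[v,u]$,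 is called an inner automorphism of $L_n$ (with inverse $\psi_{-u}$). *)

theory Defs
  imports Complex_Main "HOL-Library.Poly_Mapping"
begin

locale nonassoc_algebra = vector_space scale
  for scale :: "'k::field \<Rightarrow> 'a::ab_group_add \<Rightarrow> 'a" +
  fixes br :: "'a \<Rightarrow> 'a \<Rightarrow> 'a"
  assumes br_linear_left: "Vector_Spaces.linear scale scale (\<lambda>x. br x y)"
    and br_linear_right: "Vector_Spaces.linear scale scale (\<lambda>y. br x y)"
begin

definition is_ideal :: "'a set \<Rightarrow> bool" where
  "is_ideal I \<longleftrightarrow> subspace I \<and> (\<forall>a\<in>I. \<forall>b. br a b \<in> I \<and> br b a \<in> I)"

definition ideal_gen :: "'a set \<Rightarrow> 'a set" where
  "ideal_gen S = is_ideal hull S"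

definition metabelian_leibniz_relators :: "'a set" where
  "metabelian_leibniz_relators =
     {br (br x y) z - (br (br x z) y + br x (br y z)) | x y z. True} \<union>
     {br (br x y) (br z t) | x y z t. True}"

definition commutator_ideal :: "'a set" where
  "commutator_ideal = span {br x y | x y. True}"

definition Ann :: "'a set" where
  "Ann = ideal_gen {br x x | x. True}"

definition ad :: "'a \<Rightarrow> 'a \<Rightarrow> 'a" where
  "ad u v = br v u"

text \<open>This is the exponential of \<^term>\<open>ad u\<close>, which has square zero
  for \<open>u\<close> in the commutator ideal of a metabelian Leibniz algebra.\<close>

definition psi :: "'a \<Rightarrow> 'a \<Rightarrow> 'a" where
  "psi u v = v + ad u v"

lemma br_simps:
  "br (x + y) z = br x z + br y z" "br x (y + z) = br x y + br x z"
  "br (x - y) z = br x z - br y z" "br x (y - z) = br x y - br x z"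
  "br (scale c x) z = scale c (br x z)" "br x (scale c z) = scale c (br x z)"
  "br 0 z = 0" "br x 0 = 0"
proof -
  interpret l: Vector_Spaces.linear scale scale "\<lambda>x. br x z" for z
    by (rule br_linear_left)
  interpret r: Vector_Spaces.linear scale scale "\<lambda>y. br x y" for x
    by (rule br_linear_right)
  show "br (x + y) z = br x z + br y z" "br x (y + z) = br x y + br x z"
    "br (x - y) z = br x z - br y z" "br x (y - z) = br x y - br x z"
    "br (scale c x) z = scale c (br x z)" "br x (scale c z) = scale c (br x z)"
    "br 0 z = 0" "br x 0 = 0"
    by (rule l.add r.add l.diff r.diff l.scale r.scale l.zero r.zero)+
qed

lemma is_ideal_ideal_gen: "is_ideal (ideal_gen S)"
  unfolding ideal_gen_def
  by (rule hull_in) (auto simp: is_ideal_def intro!: subspace_Inter)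

lemma ideal_gen_superset: "S \<subseteq> ideal_gen S"
  unfolding ideal_gen_def by (rule hull_subset)

lemma ideal_gen_least: "S \<subseteq> I \<Longrightarrow> is_ideal I \<Longrightarrow> ideal_gen S \<subseteq> I"
  unfolding ideal_gen_def by (rule hull_minimal)

end

locale leibniz_algebra = nonassoc_algebra scale br
  for scale :: "'k::field \<Rightarrow> 'a::ab_group_add \<Rightarrow> 'a" and br +
  assumes leibniz: "br (br x y) z = br (br x z) y + br x (br y z)"

locale metabelian_leibniz_algebra = leibniz_algebra scale br
  for scale :: "'k::field \<Rightarrow> 'a::ab_group_add \<Rightarrow> 'a" and br +
  assumes metabelian: "br (br x y) (br z t) = 0"

text \<open>The free magma on \<open>'n\<close> is a basis of the free nonassociative algebra.\<close>

datatype 'n mag = Gen 'n | Mul "'n mag" "'n mag"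

type_synonym ('n, 'k) free_alg = "'n mag \<Rightarrow>\<^sub>0 'k"

definition lin_ext ::
  "('k::field \<Rightarrow> 'a::ab_group_add \<Rightarrow> 'a) \<Rightarrow> ('s \<Rightarrow> 'a) \<Rightarrow> ('s \<Rightarrow>\<^sub>0 'k) \<Rightarrow> 'a" where
  "lin_ext scale \<phi> f = (\<Sum>s\<in>Poly_Mapping.keys f. scale (Poly_Mapping.lookup f s) (\<phi> s))"

definition free_scale :: "'k::field \<Rightarrow> ('s \<Rightarrow>\<^sub>0 'k) \<Rightarrow> ('s \<Rightarrow>\<^sub>0 'k)" where
  "free_scale c f = Poly_Mapping.map ((*) c) f"

definition free_basis :: "'s \<Rightarrow> ('s \<Rightarrow>\<^sub>0 'k::field)" where
  "free_basis s = Poly_Mapping.single s 1"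

definition free_mult ::
  "('n, 'k::field) free_alg \<Rightarrow> ('n, 'k) free_alg \<Rightarrow> ('n, 'k) free_alg" where
  "free_mult f g =
     lin_ext free_scale (\<lambda>s. lin_ext free_scale (\<lambda>t. free_basis (Mul s t)) g) f"

definition free_act :: "('n \<Rightarrow> 'n) \<Rightarrow> ('n, 'k::field) free_alg \<Rightarrow> ('n, 'k) free_alg" where
  "free_act \<sigma> = lin_ext free_scale (\<lambda>t. free_basis (map_mag \<sigma> t))"

lemma lookup_free_scale [simp]: "Poly_Mapping.lookup (free_scale c f) s = c * Poly_Mapping.lookup f s"
  unfolding free_scale_def by transfer (auto simp: when_def)

lemma free_vector_space: "vector_space (free_scale :: 'k::field \<Rightarrow> _ \<Rightarrow> 's \<Rightarrow>\<^sub>0 'k)"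
  by unfold_locales (auto intro!: poly_mapping_eqI simp: lookup_add algebra_simps)

context vector_space
begin

lemma lin_ext_superset:
  assumes "finite A" "Poly_Mapping.keys f \<subseteq> A"
  shows "lin_ext scale \<phi> f = (\<Sum>s\<in>A. scale (Poly_Mapping.lookup f s) (\<phi> s))"
  unfolding lin_ext_def
  by (rule sum.mono_neutral_left) (use assms in \<open>auto simp: in_keys_iff\<close>)

lemma linear_lin_ext: "Vector_Spaces.linear free_scale scale (lin_ext scale \<phi>)"
proof -
  interpret F: vector_space "free_scale :: 'a \<Rightarrow> ('c \<Rightarrow>\<^sub>0 'a) \<Rightarrow> _" by (rule free_vector_space)
  show ?thesis
  proof unfold_locales
    fix f g :: "'c \<Rightarrow>\<^sub>0 'a"
    let ?A = "Poly_Mapping.keys f \<union> Poly_Mapping.keys g"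
    have "Poly_Mapping.keys (f + g) \<subseteq> ?A" by (rule Poly_Mapping.keys_add)
    then show "lin_ext scale \<phi> (f + g) = lin_ext scale \<phi> f + lin_ext scale \<phi> g"
      by (simp add: lin_ext_superset[of ?A] lookup_add scale_left_distrib sum.distrib)
  next
    fix c and f :: "'c \<Rightarrow>\<^sub>0 'a"
    have "Poly_Mapping.keys (free_scale c f) \<subseteq> Poly_Mapping.keys f"
      by (auto simp: in_keys_iff)
    then show "lin_ext scale \<phi> (free_scale c f) = scale c (lin_ext scale \<phi> f)"
      by (simp add: lin_ext_superset[of "Poly_Mapping.keys f"] scale_sum_right)
  qed
qed

lemma lin_ext_free_basis [simp]: "lin_ext scale \<phi> (free_basis s) = \<phi> s"
  by (simp add: lin_ext_def free_basis_def)

lemma lin_ext_simps: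
  "lin_ext scale \<phi> (f + g) = lin_ext scale \<phi> f + lin_ext scale \<phi> g"
  "lin_ext scale \<phi> (f - g) = lin_ext scale \<phi> f - lin_ext scale \<phi> g"
  "lin_ext scale \<phi> (free_scale c f) = scale c (lin_ext scale \<phi> f)"
  "lin_ext scale \<phi> 0 = 0"
proof -
  interpret Vector_Spaces.linear free_scale scale "lin_ext scale \<phi>" by (rule linear_lin_ext)
  show "lin_ext scale \<phi> (f + g) = lin_ext scale \<phi> f + lin_ext scale \<phi> g"
    "lin_ext scale \<phi> (f - g) = lin_ext scale \<phi> f - lin_ext scale \<phi> g"
    "lin_ext scale \<phi> (free_scale c f) = scale c (lin_ext scale \<phi> f)"
    "lin_ext scale \<phi> 0 = 0"
    by (rule add diff scale zero)+
qed

lemma lin_ext_fun: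
  "lin_ext scale (\<lambda>s. \<phi> s + \<chi> s) f = lin_ext scale \<phi> f + lin_ext scale \<chi> f"
  "lin_ext scale (\<lambda>s. scale c (\<phi> s)) f = scale c (lin_ext scale \<phi> f)"
  by (simp_all add: lin_ext_def scale_right_distrib sum.distrib scale_sum_right mult.commute)

end

global_interpretation free: nonassoc_algebra
  "free_scale :: 'k::field \<Rightarrow> ('n, 'k) free_alg \<Rightarrow> _" free_mult
proof -
  interpret vector_space "free_scale :: 'k \<Rightarrow> ('n, 'k) free_alg \<Rightarrow> _"
    by (rule free_vector_space)
  show "nonassoc_algebra (free_scale :: 'k \<Rightarrow> ('n, 'k) free_alg \<Rightarrow> _) free_mult"
    by unfold_locales (simp_all add: free_mult_def lin_ext_simps lin_ext_fun)
qed

lemma free_mult_basis: "free_mult (free_basis s) (free_basis t) = free_basis (Mul s t)"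
  by (simp add: free_mult_def)

lemma free_alg_induct [case_names zero add]:
  fixes f :: "('s \<Rightarrow>\<^sub>0 'k::field)"
  assumes "P 0" "\<And>c s f. P f \<Longrightarrow> P (free_scale c (free_basis s) + f)"
  shows "P f"
proof (induction f rule: update_induct)
  case const
  show ?case by (rule assms)
next
  case (update f a b)
  then have "Poly_Mapping.update a b f = free_scale b (free_basis a) + f"
    by (auto intro!: poly_mapping_eqI
        simp: free_basis_def lookup_update lookup_single lookup_add when_def in_keys_iff)
  then show ?case using assms update by metis
qed

lemma lin_ext_hom:
  assumes "nonassoc_algebra scale br"
    and "\<And>s t. \<phi> (Mul s t) = br (\<phi> s) (\<phi> t)"
  shows "lin_ext scale \<phi> (free_mult f g) = br (lin_ext scale \<phi> f) (lin_ext scale \<phi> g)"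
proof -
  interpret nonassoc_algebra scale br by fact
  have *: "lin_ext scale \<phi> (free_mult (free_basis s) g) = br (\<phi> s) (lin_ext scale \<phi> g)" for s
    by (induction g rule: free_alg_induct)
       (simp_all add: free.br_simps br_simps lin_ext_simps free_mult_basis assms)
  show ?thesis
    by (induction f rule: free_alg_induct)
       (simp_all add: free.br_simps br_simps lin_ext_simps *)
qed

text \<open>The quotient of the free nonassociative algebra by the ideal generated by all values of
  the defining identities of the variety. For finite \<open>'n\<close> this is the algebra \<open>L\<^sub>n\<close> with
  \<open>n = CARD('n)\<close>.\<close>

definition ml_rel :: "('n, 'k::field) free_alg \<Rightarrow> ('n, 'k) free_alg \<Rightarrow> bool" where
  "ml_rel f g \<longleftrightarrow> f - g \<in> free.ideal_gen free.metabelian_leibniz_relators"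

lemma free_ideal:
  fixes S :: "('n, 'k::field) free_alg set"
  shows "0 \<in> free.ideal_gen S"
    "f \<in> free.ideal_gen S \<Longrightarrow> g \<in> free.ideal_gen S \<Longrightarrow> f + g \<in> free.ideal_gen S"
    "f \<in> free.ideal_gen S \<Longrightarrow> g \<in> free.ideal_gen S \<Longrightarrow> f - g \<in> free.ideal_gen S"
    "f \<in> free.ideal_gen S \<Longrightarrow> - f \<in> free.ideal_gen S"
    "f \<in> free.ideal_gen S \<Longrightarrow> free_scale c f \<in> free.ideal_gen S"
    "f \<in> free.ideal_gen S \<Longrightarrow> free_mult f g \<in> free.ideal_gen S"
    "f \<in> free.ideal_gen S \<Longrightarrow> free_mult g f \<in> free.ideal_gen S"
  using free.is_ideal_ideal_gen[of S] unfolding free.is_ideal_def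
  by (auto intro: free.subspace_0 free.subspace_add free.subspace_diff free.subspace_neg
      free.subspace_scale)

quotient_type (overloaded) ('n, 'k) free_ml = "('n, 'k::field) free_alg" / ml_rel
proof (rule equivpI)
  show "reflp (ml_rel :: ('n, 'k) free_alg \<Rightarrow> _)"
    by (rule reflpI) (simp add: ml_rel_def free_ideal)
  show "symp (ml_rel :: ('n, 'k) free_alg \<Rightarrow> _)"
    by (rule sympI) (unfold ml_rel_def, drule free_ideal(4), simp)
  show "transp (ml_rel :: ('n, 'k) free_alg \<Rightarrow> _)"
    by (rule transpI) (unfold ml_rel_def, drule (1) free_ideal(2), simp)
qed

instantiation free_ml :: (type, field) ab_group_add
begin

lift_definition zero_free_ml :: "('a, 'b) free_ml" is 0 .

lift_definition plus_free_ml :: "('a, 'b) free_ml \<Rightarrow> ('a, 'b) free_ml \<Rightarrow> ('a, 'b) free_ml"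
  is "(+)"
  unfolding ml_rel_def by (simp add: add_diff_add free_ideal(2))

lift_definition minus_free_ml :: "('a, 'b) free_ml \<Rightarrow> ('a, 'b) free_ml \<Rightarrow> ('a, 'b) free_ml"
  is "(-)"
  unfolding ml_rel_def by (drule (1) free_ideal(3)) (simp add: algebra_simps)

lift_definition uminus_free_ml :: "('a, 'b) free_ml \<Rightarrow> ('a, 'b) free_ml" is uminus
  unfolding ml_rel_def by (drule free_ideal(4)) simp

instance
  by standard (transfer; simp add: ml_rel_def free_ideal algebra_simps)+

end

lift_definition ml_scale :: "'k::field \<Rightarrow> ('n, 'k) free_ml \<Rightarrow> ('n, 'k) free_ml"
  is free_scale
  unfolding ml_rel_def by (simp add: free_ideal(5) flip: free.scale_right_diff_distrib)

lift_definition ml_br :: "('n, 'k::field) free_ml \<Rightarrow> ('n, 'k) free_ml \<Rightarrow> ('n, 'k) free_ml"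
  is free_mult
proof -
  fix f f' g g' :: "('n, 'k) free_alg"
  assume *: "ml_rel f f'" "ml_rel g g'"
  have "free_mult f g - free_mult f' g' = free_mult (f - f') g + free_mult f' (g - g')"
    by (simp add: free.br_simps)
  then show "ml_rel (free_mult f g) (free_mult f' g')"
    using * by (simp add: ml_rel_def free_ideal)
qed

lift_definition gen :: "'n \<Rightarrow> ('n, 'k::field) free_ml" is "\<lambda>i. free_basis (Gen i)" .

lemma lin_ext_relators:
  assumes "metabelian_leibniz_algebra scale br"
    and "\<And>s t. \<phi> (Mul s t) = br (\<phi> s) (\<phi> t)"
    and "f \<in> free.ideal_gen free.metabelian_leibniz_relators"
  shows "lin_ext scale \<phi> f = 0"
proof -
  interpret metabelian_leibniz_algebra scale br by fact
  note hom = lin_ext_hom[OF nonassoc_algebra_axioms, of \<phi>, OF assms(2)]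
  have "free.is_ideal {f. lin_ext scale \<phi> f = 0}"
    by (auto simp: free.is_ideal_def free.subspace_def lin_ext_simps hom br_simps)
  moreover have "free.metabelian_leibniz_relators \<subseteq> {f. lin_ext scale \<phi> f = 0}"
    by (auto simp: free.metabelian_leibniz_relators_def lin_ext_simps hom metabelian
        simp flip: leibniz)
  ultimately show ?thesis using free.ideal_gen_least assms(3) by blast
qed

global_interpretation ml: metabelian_leibniz_algebra
  "ml_scale :: 'k::field \<Rightarrow> ('n, 'k) free_ml \<Rightarrow> _" ml_br
proof -
  have r: "free_mult (free_mult x y) z - (free_mult (free_mult x z) y + free_mult x (free_mult y z))
        \<in> free.ideal_gen free.metabelian_leibniz_relators"
    "free_mult (free_mult x y) (free_mult z t)
        \<in> free.ideal_gen free.metabelian_leibniz_relators"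
    for x y z t :: "('n, 'k) free_alg"
    using free.ideal_gen_superset[of free.metabelian_leibniz_relators]
    unfolding free.metabelian_leibniz_relators_def by blast+
  interpret vector_space "ml_scale :: 'k \<Rightarrow> ('n, 'k) free_ml \<Rightarrow> _"
    by unfold_locales
       (transfer; simp add: ml_rel_def free_ideal free.scale_right_distrib
          free.scale_left_distrib)+
  show "metabelian_leibniz_algebra (ml_scale :: 'k \<Rightarrow> ('n, 'k) free_ml \<Rightarrow> _) ml_br"
  proof (unfold_locales, goal_cases)
    case (5 x y z)
    show ?case
      by transfer (simp add: ml_rel_def r)
  next
    case (6 x y z t)
    show ?case
      by transfer (simp add: ml_rel_def r)
  qed (transfer; simp add: ml_rel_def free_ideal free.br_simps)+
qed

primrec eval_mag :: "('a \<Rightarrow> 'a \<Rightarrow> 'a) \<Rightarrow> ('n \<Rightarrow> 'a) \<Rightarrow> 'n mag \<Rightarrow> 'a" where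
  "eval_mag br \<phi> (Gen i) = \<phi> i"
| "eval_mag br \<phi> (Mul s t) = br (eval_mag br \<phi> s) (eval_mag br \<phi> t)"

lemma free_ml_universal:
  fixes scale :: "'k::field \<Rightarrow> 'a::ab_group_add \<Rightarrow> 'a" and \<phi> :: "'n \<Rightarrow> 'a"
  assumes "metabelian_leibniz_algebra scale br"
  shows "\<exists>!h. Vector_Spaces.linear ml_scale scale h \<and>
           (\<forall>x y. h (ml_br x y) = br (h x) (h y)) \<and> (\<forall>i. h (gen i) = \<phi> i)"
proof -
  interpret metabelian_leibniz_algebra scale br by fact
  define H where "H = lin_ext scale (eval_mag br \<phi>)"
  define h where "h q = H (rep_free_ml q)" for q
  have H_cong: "H f = H g" if "ml_rel f g" for f g
    using lin_ext_relators[OF assms, of "eval_mag br \<phi>" "f - g"] that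
    by (simp add: H_def ml_rel_def lin_ext_simps)
  have h_abs: "h (abs_free_ml f) = H f" for f
    unfolding h_def
    by (rule H_cong) (metis Quotient_rep_abs[OF Quotient_free_ml] free_ml.abs_eq_iff)
  have hom: "H (free_mult f g) = br (H f) (H g)" for f g
    unfolding H_def by (rule lin_ext_hom[OF nonassoc_algebra_axioms]) simp
  show ?thesis
  proof (rule ex1I[of _ h], intro conjI allI)
    have "h (x + y) = h x + h y" for x y
      by (induction x; induction y)
         (simp add: plus_free_ml.abs_eq h_abs H_def lin_ext_simps)
    moreover have "h (ml_scale c x) = scale c (h x)" for c x
      by (induction x) (simp add: ml_scale.abs_eq h_abs H_def lin_ext_simps)
    ultimately show "Vector_Spaces.linear ml_scale scale h"
      by unfold_locales
    show "h (ml_br x y) = br (h x) (h y)" for x y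
      by (induction x; induction y) (simp add: ml_br.abs_eq h_abs hom)
    show "h (gen i) = \<phi> i" for i
      by (simp add: gen.abs_eq h_abs H_def)
  next
    fix k assume k: "Vector_Spaces.linear ml_scale scale k \<and>
      (\<forall>x y. k (ml_br x y) = br (k x) (k y)) \<and> (\<forall>i. k (gen i) = \<phi> i)"
    then interpret k: Vector_Spaces.linear ml_scale scale k by blast
    have basis: "k (abs_free_ml (free_basis s)) = eval_mag br \<phi> s" for s
    proof (induction s)
      case (Gen i)
      then show ?case using k by (simp flip: gen.abs_eq)
    next
      case (Mul s t)
      then show ?case using k by (simp flip: free_mult_basis ml_br.abs_eq)
    qed
    have k_abs: "k (abs_free_ml f) = H f" for f
      by (induction f rule: free_alg_induct)
         (simp_all add: H_def lin_ext_simps basis k.add k.scale k.zero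
            flip: zero_free_ml.abs_eq plus_free_ml.abs_eq ml_scale.abs_eq zero_free_ml_def)
    show "k = h"
      by (intro ext, rule free_ml.abs_induct) (simp add: h_abs k_abs)
  qed
qed

lemma free_act_simps:
  "free_act \<sigma> (p + q) = free_act \<sigma> p + free_act \<sigma> q"
  "free_act \<sigma> (p - q) = free_act \<sigma> p - free_act \<sigma> q"
  "free_act \<sigma> (free_scale c p) = free_scale c (free_act \<sigma> p)"
  "free_act \<sigma> 0 = 0"
  "free_act \<sigma> (free_basis t) = free_basis (map_mag \<sigma> t)"
  "free_act \<sigma> (free_mult p q) = free_mult (free_act \<sigma> p) (free_act \<sigma> q)"
  unfolding free_act_def
  by (auto simp: free.lin_ext_simps free_mult_basis intro!: lin_ext_hom
      free.nonassoc_algebra_axioms)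

lift_definition act :: "('n \<Rightarrow> 'n) \<Rightarrow> ('n, 'k::field) free_ml \<Rightarrow> ('n, 'k) free_ml"
  is free_act
proof -
  fix \<sigma> :: "'n \<Rightarrow> 'n" and f g :: "('n, 'k) free_alg"
  assume *: "ml_rel f g"
  let ?I = "free.ideal_gen free.metabelian_leibniz_relators :: ('n, 'k) free_alg set"
  have "free.is_ideal {f. free_act \<sigma> f \<in> ?I}"
    by (auto simp: free.is_ideal_def free.subspace_def free_act_simps free_ideal)
  moreover have "free.metabelian_leibniz_relators \<subseteq> {f. free_act \<sigma> f \<in> ?I}"
  proof -
    have "free_act \<sigma> f \<in> free.metabelian_leibniz_relators"
      if "f \<in> free.metabelian_leibniz_relators" for f :: "('n, 'k) free_alg"
      using that unfolding free.metabelian_leibniz_relators_def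
      by (auto simp: free_act_simps) blast+
    then show ?thesis using free.ideal_gen_superset by blast
  qed
  ultimately have "?I \<subseteq> {f. free_act \<sigma> f \<in> ?I}" by (rule free.ideal_gen_least[rotated])
  then show "ml_rel (free_act \<sigma> f) (free_act \<sigma> g)"
    using * by (auto simp: ml_rel_def simp flip: free_act_simps)
qed

lemma act_hom:
  fixes x y :: "('n, 'k::field) free_ml"
  shows "Vector_Spaces.linear ml_scale ml_scale (act \<sigma> :: ('n, 'k) free_ml \<Rightarrow> _)"
    and "act \<sigma> (ml_br x y) = ml_br (act \<sigma> x) (act \<sigma> y)"
    and "act \<sigma> (gen i :: ('n, 'k) free_ml) = gen (\<sigma> i)"
proof -
  show "Vector_Spaces.linear ml_scale ml_scale (act \<sigma> :: ('n, 'k) free_ml \<Rightarrow> _)"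
    by unfold_locales (transfer; simp add: free_act_simps ml_rel_def free_ideal)+
  show "act \<sigma> (ml_br x y) = ml_br (act \<sigma> x) (act \<sigma> y)"
    by transfer (simp add: free_act_simps ml_rel_def free_ideal)
  show "act \<sigma> (gen i :: ('n, 'k) free_ml) = gen (\<sigma> i)"
    by transfer (simp add: free_act_simps ml_rel_def free_ideal)
qed

definition sym_polys :: "('n::finite, 'k::field) free_ml set" where
  "sym_polys = {v. \<forall>\<sigma>. bij \<sigma> \<longrightarrow> act \<sigma> v = v}"

definition Inn_sym :: "(('n::finite, 'k::field) free_ml \<Rightarrow> ('n, 'k) free_ml) set" where
  "Inn_sym = {ml.psi u | u. u \<in> ml.commutator_ideal \<and> (\<forall>v\<in>sym_polys. ml.psi u v \<in> sym_polys)}"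

end

theory Submission
  imports Defs "HOL-Library.Product_Plus"
begin

text \<open>
  The inclusion from right to left rests on \<open>[v, [x, x]] = 0\<close>, an instance of the Leibniz identity:
  it propagates to \<open>[v, u\<^sub>1] = 0\<close> for every \<open>u\<^sub>1\<close> in the annihilator ideal
  (\<open>br_Ann_right\<close>). So \<open>u\<^sub>1\<close> does not contribute to \<open>\<psi>\<close>, and a symmetric \<open>u\<^sub>2\<close> brackets
  symmetric elements into symmetric elements.

  For the converse, let \<open>\<psi>\<^sub>u\<close> preserve symmetry and put \<open>s = x\<^sub>1 + \<dots> + x\<^sub>n\<close>. Both \<open>s\<close> and
  \<open>[s, u]\<close> are symmetric, so \<open>[s, u] = \<sigma>[s, u] = [s, \<sigma>u]\<close> for each permutation \<open>\<sigma>\<close>. The decisive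
  fact is that \<open>s\<close> detects right multiplications: \<open>[s, w] = 0\<close> forces \<open>[v, w] = 0\<close> for all
  \<open>v\<close> (\<open>ml_br_eq_of_br_sum_gen\<close>). Indeed each defining identity of the variety is linear in
  its leftmost variable and keeps it leftmost, so the algebra is free as a right module over itself,
  and there is a linear map \<open>T\<close> with \<open>T[a, b] = [T a, b]\<close> and arbitrary prescribed values on the
  generators (\<open>ml_right_module_endo\<close>); choose \<open>T\<close> with \<open>T s = v\<close> and apply it to
  \<open>[s, w] = 0\<close>. Consequently \<open>u\<close> and all \<open>\<sigma>u\<close> define the same right multiplication, hence so does
  the average of the \<open>\<sigma>u\<close>, which exists in characteristic zero, is symmetric, and lies in the
  commutator ideal. Thus \<open>u\<^sub>1 = 0\<close> already suffices to represent \<open>\<psi>\<^sub>u\<close>.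
\<close>

text \<open>The elements that annihilate the algebra from the right form an ideal, because the Leibniz
  identity expresses \<open>[v, [a, b]]\<close> through \<open>[[v, a], b]\<close> and \<open>[[v, b], a]\<close>; it contains the
  squares since these two terms agree for \<open>a = b\<close>.\<close>

lemma (in leibniz_algebra) br_Ann_right:
  assumes "u \<in> Ann"
  shows "br v u = 0"
proof -
  have br_br: "br v (br a b) = br (br v a) b - br (br v b) a" for v a b
    by (simp add: leibniz[of v a b])
  have "is_ideal {u. \<forall>v. br v u = 0}"
    by (auto simp: is_ideal_def subspace_def br_simps br_br)
  moreover have "{br x x | x. True} \<subseteq> {u. \<forall>v. br v u = 0}"
    by (auto simp: br_br)
  ultimately show ?thesis
    using ideal_gen_least assms unfolding Ann_def by blast
qed

lemma ml_endo_eq_id: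
  fixes h :: "('n, 'k::field) free_ml \<Rightarrow> ('n, 'k) free_ml"
  assumes "Vector_Spaces.linear ml_scale ml_scale h"
    and "\<And>x y. h (ml_br x y) = ml_br (h x) (h y)"
    and "\<And>i. h (gen i) = gen i"
  shows "h x = x"
proof -
  have "Vector_Spaces.linear ml_scale ml_scale (\<lambda>x :: ('n, 'k) free_ml. x)"
    by unfold_locales (simp_all add: ml.scale_right_distrib)
  then have "h = (\<lambda>x. x)"
    using free_ml_universal[OF ml.metabelian_leibniz_algebra_axioms,
        of "gen :: 'n \<Rightarrow> ('n, 'k) free_ml"] assms
    by (metis (lifting))
  then show ?thesis by simp
qed

text \<open>The split extension of the algebra by its own right regular module, with
  \<open>[(a, m), (b, n)] = ([a, b], [m, b])\<close>, is again a metabelian Leibniz algebra. A homomorphism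
  into it that is the identity in the first component is exactly a right module map in the
  second.\<close>

lemma ml_right_module_endo:
  fixes y :: "'n \<Rightarrow> ('n, 'k::field) free_ml"
  obtains T where "Vector_Spaces.linear ml_scale ml_scale T"
    and "\<And>a b. T (ml_br a b) = ml_br (T a) b"
    and "\<And>i. T (gen i) = y i"
proof -
  define sc :: "'k \<Rightarrow> ('n, 'k) free_ml \<times> ('n, 'k) free_ml \<Rightarrow> _"
    where "sc c p = (ml_scale c (fst p), ml_scale c (snd p))" for c p
  define b :: "('n, 'k) free_ml \<times> ('n, 'k) free_ml \<Rightarrow> ('n, 'k) free_ml \<times> ('n, 'k) free_ml \<Rightarrow> _"
    where "b p q = (ml_br (fst p) (fst q), ml_br (snd p) (fst q))" for p q
  interpret P: vector_space sc
    by unfold_locales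
       (simp_all add: sc_def prod_eq_iff ml.scale_right_distrib ml.scale_left_distrib)
  have "metabelian_leibniz_algebra sc b"
    by unfold_locales
       (simp_all add: sc_def b_def prod_eq_iff ml.br_simps ml.metabelian flip: ml.leibniz)
  from free_ml_universal[OF this, of "\<lambda>i. (gen i, y i)"]
  obtain h where lin: "Vector_Spaces.linear ml_scale sc h"
    and hom: "\<And>x z. h (ml_br x z) = b (h x) (h z)" and h_gen: "\<And>i. h (gen i) = (gen i, y i)"
    by blast
  interpret h: Vector_Spaces.linear ml_scale sc h by (rule lin)
  have "Vector_Spaces.linear ml_scale ml_scale (\<lambda>x. fst (h x))"
    by unfold_locales (simp_all add: h.add h.scale sc_def)
  then have fst_h: "fst (h x) = x" for x
    by (rule ml_endo_eq_id) (simp_all add: hom h_gen b_def)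
  have "Vector_Spaces.linear ml_scale ml_scale (\<lambda>x. snd (h x))"
    by unfold_locales (simp_all add: h.add h.scale sc_def)
  then show thesis
    by (rule that) (simp_all add: hom h_gen b_def fst_h)
qed

text \<open>A right module map that sends one generator to \<open>v\<close> and the others to \<open>0\<close> sends their
  sum to \<open>v\<close>, so it carries the hypothesis to the conclusion.\<close>

lemma ml_br_eq_of_br_sum_gen:
  fixes u w :: "('n::finite, 'k::field) free_ml"
  assumes "ml_br (\<Sum>i\<in>UNIV. gen i) u = ml_br (\<Sum>i\<in>UNIV. gen i) w"
  shows "ml_br v u = ml_br v w"
proof -
  fix j :: 'n
  obtain T :: "('n, 'k) free_ml \<Rightarrow> ('n, 'k) free_ml"
    where lin: "Vector_Spaces.linear ml_scale ml_scale T"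
      and T_br: "\<And>a b. T (ml_br a b) = ml_br (T a) b"
      and T_gen: "\<And>i. T (gen i) = (if i = j then v else 0)"
    by (rule ml_right_module_endo[of "\<lambda>i. if i = j then v else 0"]) blast
  interpret T: Vector_Spaces.linear ml_scale ml_scale T by (rule lin)
  have "T (\<Sum>i\<in>UNIV. gen i) = v"
    by (simp add: T.sum T_gen)
  then show ?thesis
    using arg_cong[OF assms, of T] by (simp add: T_br)
qed

lemma act_comp: "act \<sigma> (act \<tau> u) = act (\<sigma> \<circ> \<tau>) (u :: ('n, 'k::field) free_ml)"
proof (induction u)
  case (1 f)
  have "free_act \<sigma> (free_act \<tau> f) = free_act (\<sigma> \<circ> \<tau>) f"
    by (induction f rule: free_alg_induct) (simp_all add: free_act_simps mag.map_comp comp_def)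
  then show ?case by (simp only: act.abs_eq)
qed

lemma act_commutator_ideal:
  fixes u :: "('n, 'k::field) free_ml"
  assumes "u \<in> ml.commutator_ideal"
  shows "act \<sigma> u \<in> ml.commutator_ideal"
proof -
  interpret act: Vector_Spaces.linear ml_scale ml_scale "act \<sigma> :: ('n, 'k) free_ml \<Rightarrow> _"
    by (rule act_hom)
  show ?thesis
    using assms unfolding ml.commutator_ideal_def
  proof (induction rule: ml.span_induct_alt)
    case base
    show ?case by (simp add: act.zero ml.span_zero)
  next
    case (step c x y)
    then obtain p q where "x = ml_br p q"
      by blast
    then have "act \<sigma> x \<in> {ml_br x y | x y. True}"
      by (simp only: act_hom) blast
    with step show ?case
      by (simp add: act.add act.scale ml.span_add ml.span_scale ml.span_base)
  qed
qed

lemma sum_gen_symmetric: "(\<Sum>i\<in>UNIV. gen i) \<in> (sym_polys :: ('n::finite, 'k::field) free_ml set)"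
  unfolding sym_polys_def
proof safe
  fix \<sigma> :: "'n \<Rightarrow> 'n" assume \<sigma>: "bij \<sigma>"
  interpret act: Vector_Spaces.linear ml_scale ml_scale "act \<sigma> :: ('n, 'k) free_ml \<Rightarrow> _"
    by (rule act_hom)
  show "act \<sigma> (\<Sum>i\<in>UNIV. gen i) = (\<Sum>i\<in>UNIV. gen i :: ('n, 'k) free_ml)"
    using sum.reindex_bij_betw[OF \<sigma>, of "gen :: 'n \<Rightarrow> ('n, 'k) free_ml"]
    by (simp add: act.sum act_hom)
qed

lemma psi_preserves_sym_polys:
  fixes u v :: "('n::finite, 'k::field) free_ml"
  assumes "u \<in> sym_polys" "v \<in> sym_polys"
  shows "ml.psi u v \<in> sym_polys"
proof -
  have "act \<sigma> (v + ml_br v u) = act \<sigma> v + ml_br (act \<sigma> v) (act \<sigma> u)" for \<sigma> :: "'n \<Rightarrow> 'n"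
  proof -
    interpret act: Vector_Spaces.linear ml_scale ml_scale "act \<sigma> :: ('n, 'k) free_ml \<Rightarrow> _"
      by (rule act_hom)
    show ?thesis by (simp add: act.add act_hom)
  qed
  then show ?thesis
    using assms by (simp add: sym_polys_def ml.psi_def ml.ad_def)
qed

definition sym_average :: "('n::finite, 'k::field) free_ml \<Rightarrow> ('n, 'k) free_ml" where
  "sym_average u = ml_scale (inverse (of_nat (card {\<sigma> :: 'n \<Rightarrow> 'n. bij \<sigma>})))
     (\<Sum>\<sigma> | bij \<sigma>. act \<sigma> u)"

lemma sym_average_symmetric: "sym_average u \<in> (sym_polys :: ('n::finite, 'k::field) free_ml set)"
  unfolding sym_polys_def
proof safe
  fix \<tau> :: "'n \<Rightarrow> 'n" assume \<tau>: "bij \<tau>"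
  interpret act: Vector_Spaces.linear ml_scale ml_scale "act \<tau> :: ('n, 'k) free_ml \<Rightarrow> _"
    by (rule act_hom)
  have "bij_betw (\<lambda>\<sigma>. \<tau> \<circ> \<sigma>) {\<sigma> :: 'n \<Rightarrow> 'n. bij \<sigma>} {\<sigma>. bij \<sigma>}"
    by (rule bij_betw_byWitness[where f' = "\<lambda>\<sigma>. inv \<tau> \<circ> \<sigma>"])
       (use \<tau> in \<open>auto intro: bij_comp bij_imp_bij_inv
          simp: fun_eq_iff bij_is_inj bij_is_surj surj_f_inv_f\<close>)
  from sum.reindex_bij_betw[OF this, of "\<lambda>\<sigma>. act \<sigma> u"]
  show "act \<tau> (sym_average u) = sym_average u"
    by (simp add: sym_average_def act.scale act.sum act_comp)
qed

lemma sym_average_commutator_ideal: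
  "u \<in> ml.commutator_ideal \<Longrightarrow> sym_average u \<in> ml.commutator_ideal"
  using act_commutator_ideal unfolding sym_average_def ml.commutator_ideal_def
  by (intro ml.span_scale ml.span_sum) blast

lemma br_sym_average:
  fixes u v :: "('n::finite, 'k::field_char_0) free_ml"
  assumes "\<And>\<sigma>. bij \<sigma> \<Longrightarrow> ml_br v (act \<sigma> u) = ml_br v u"
  shows "ml_br v (sym_average u) = ml_br v u"
proof -
  let ?S = "{\<sigma> :: 'n \<Rightarrow> 'n. bij \<sigma>}"
  interpret br: Vector_Spaces.linear ml_scale ml_scale "ml_br v"
    by (rule ml.br_linear_right)
  have "id \<in> ?S" by simp
  then have card: "card ?S \<noteq> 0" by (auto simp: card_eq_0_iff)
  have "ml_br v (sym_average u) = ml_scale (inverse (of_nat (card ?S))) (\<Sum>\<sigma>\<in>?S. ml_br v u)"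
    by (simp add: sym_average_def br.scale br.sum assms)
  also have "(\<Sum>\<sigma>\<in>?S. ml_br v u) = ml_scale (of_nat (card ?S)) (ml_br v u)"
    by (simp only: ml.sum_constant_scale)
  finally show ?thesis
    using card by simp
qed

theorem theorem2p5:
  shows "(Inn_sym :: (('n::finite, 'k::field_char_0) free_ml \<Rightarrow> ('n, 'k) free_ml) set) =
    {ml.psi (u1 + u2) | u1 u2. u1 \<in> ml.Ann \<and> u2 \<in> ml.commutator_ideal \<inter> sym_polys}"
proof (intro equalityI subsetI)
  fix f :: "('n, 'k) free_ml \<Rightarrow> ('n, 'k) free_ml"
  assume "f \<in> Inn_sym"
  then obtain u where f: "f = ml.psi u" and u: "u \<in> ml.commutator_ideal"
    and pres: "\<And>v. v \<in> sym_polys \<Longrightarrow> ml.psi u v \<in> sym_polys"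
    by (auto simp: Inn_sym_def)
  let ?s = "\<Sum>i\<in>UNIV. gen i :: ('n, 'k) free_ml"
  have "ml_br ?s (act \<sigma> u) = ml_br ?s u" if \<sigma>: "bij \<sigma>" for \<sigma>
  proof -
    interpret act: Vector_Spaces.linear ml_scale ml_scale "act \<sigma> :: ('n, 'k) free_ml \<Rightarrow> _"
      by (rule act_hom)
    have "act \<sigma> ?s = ?s" "act \<sigma> (?s + ml_br ?s u) = ?s + ml_br ?s u"
      using sum_gen_symmetric pres[OF sum_gen_symmetric] \<sigma>
      by (auto simp: sym_polys_def ml.psi_def ml.ad_def)
    then show ?thesis by (simp add: act.add act_hom)
  qed
  then have "ml_br v (sym_average u) = ml_br v u" for v
    by (rule br_sym_average[OF ml_br_eq_of_br_sum_gen])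
  then have "f = ml.psi (0 + sym_average u)"
    by (simp add: f fun_eq_iff ml.psi_def ml.ad_def)
  moreover have "0 \<in> (ml.Ann :: ('n, 'k) free_ml set)"
    unfolding ml.Ann_def using ml.is_ideal_ideal_gen ml.is_ideal_def ml.subspace_0 by blast
  ultimately show
    "f \<in> {ml.psi (u1 + u2) | u1 u2. u1 \<in> ml.Ann \<and> u2 \<in> ml.commutator_ideal \<inter> sym_polys}"
    using sym_average_commutator_ideal[OF u] sym_average_symmetric by blast
next
  fix f :: "('n, 'k) free_ml \<Rightarrow> ('n, 'k) free_ml"
  assume "f \<in> {ml.psi (u1 + u2) | u1 u2. u1 \<in> ml.Ann \<and> u2 \<in> ml.commutator_ideal \<inter> sym_polys}"
  then obtain u1 u2 where f: "f = ml.psi (u1 + u2)" and u1: "u1 \<in> ml.Ann"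
    and u2: "u2 \<in> ml.commutator_ideal" "u2 \<in> sym_polys"
    by blast
  have "f = ml.psi u2"
    by (simp add: f fun_eq_iff ml.psi_def ml.ad_def ml.br_simps ml.br_Ann_right[OF u1])
  then show "f \<in> Inn_sym"
    using u2 psi_preserves_sym_polys unfolding Inn_sym_def by blast
qed

end
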